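(* Let $R$ be a finite subset of a metric space $(X,d)$ having the aspect ratio $\Delta(R)$. The algorithm $\mathrm{BuildTree}$ (described in the context) builds a compressed cover tree $\mathcal{T}(R)$ in time $$O\big((c_m(R))^8\cdot \log_2(\Delta(R))\cdot |R|\big),$$ where $c_m(R)$ is the minimized expansion constant of $R$ and the constant hidden in $O(\cdot)$ is absolute.
   Context: **Aspect ratio.** For a finite set $R$ with a metric $d$, $\mathrm{diam}(R)=\max_{p,q\in R}d(p,q)$, $d_{\min}(R)$ is the shortest distance between distinct points of $R$, and $\Delta(R)=\mathrm{diam}(R)/d_{\min}(R)$. **Minimized expansion constant.** $\bar B(p,t)$ is the closed ball with center $p$ and radius $t\ge 0$. A set $A\subseteq X$ is locally finite if $\bar B(p,t)\cap A$ is finite for all $p\in X$, $t\ge 0$. For finite $R\subseteq X$, $$c_m(R)=\lim_{\xi\to 0^+}\ \inf_{R\subseteq A\subseteq X}\ \sup_{p\in A,\,t>\xi}\frac{|\bar B(p,2t)\cap A|}{|\bar B(p,t)\cap A|},$$ where $A$ runs over locally finite sets containing $R$. **Compressed cover tree.** For a finite set $R\subseteq X$, a compressed cover tree $\mathcal T(R)$ is a rooted tree with vertex set $R$, a root $r$ and a level function $l:R\to\mathbb Z$ such that: (a) $l(r)\ge 1+\max_{p\in R\setminus\{r\}}l(p)$; (b) every $q\in R\setminus\{r\}$ has a unique parent $p$, and $d(q,p)\le 2^{l(q)+1}$, $l(q)<l(p)$; (c) for each $i\in\mathbb Z$ the cover set $C_i=\{p\in R: l(p)\ge i\}$ satisfies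 $d(p,q)>2^i$ for all distinct $p,q\in C_i$. While a tree is being built, its root is kept at level $+\infty$. Let $l_{\min}$ be the minimum level of a node. **Next level.** For a node $a$ and level $i$, $\mathrm{Next}(a,i)$ is the maximal level $j<i$ such that $a$ has a child (different from $a$) of level $j$; if none exists, $\mathrm{Next}(a,i)=l_{\min}-1$. **Algorithm BuildTree.** Input: finite $R$ with a chosen root $r\in R$. Start with the tree on $\{r\}$ with $l(r)=+\infty$. For each $p\in R\setminus\{r\}$, in arbitrary order, replace the current tree $\mathcal T(W)$ by $\mathrm{AddPoint}(\mathcal T(W),p)$, a tree on $W\cup\{p\}$. At the end set $l(r)=1+\max_{p\in R\setminus\{r\}}l(p)$. **AddPoint$(\mathcal T(W),p)$.** Set $R_{+\infty}=\{r\}$ and store it in a dictionary $M$ under the key $+\infty$. If $W\neq\{r\}$, let $i$ be the maximum level of a node in $W\setminus\{r\}$ and $i^+=+\infty$. While $i\ge l_{\min}(\mathcal T(W))$ (the loop is skipped if $W=\{r\}$): put $\mathcal C_i=R_{i^+}\cup\{a : a\text{ is a child of some }q\in R_{i^+},\ l(a)=i\}$ and $R_i=\{a\in\mathcal C_i: d(p,a)\le 2^{i+1}\}$, store $M[i]=R_i$; if $R_i=\emptyset$ leave the loop; otherwise let $t=\max_{a\in R_i}\mathrm{Next}(a,i)$, set $t^+=i$ and $i\leftarrow t$. After the loop, go through the keys $i$ of $M$ in increasing order and stop at the first key with $d(p,R_i)\le 2^i$ (where $d(p,\emptyset)=+\infty$ only for finite keys fails the test, and $2^{+\infty}=+\infty$):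 choose $q\in R_i$ with $d(p,q)=d(p,R_i)$, let $x$ be the maximal integer with $d(p,q)>2^x$, set $l(p)=x$ and make $q$ the parent of $p$. **Cost conventions.** Distance evaluations and elementary operations have unit cost. For each node, its children are stored grouped by level in a linked hash map, so that the group at a given level, the passage from level $i$ to $\mathrm{Next}(a,i)$, and the top child level are accessible in $O(1)$ time. A logarithmic factor inside $O(\cdot)$ is read as $\max\{1,\log_2(\cdot)\}$. *)

theory Defs
  imports "HOL-Analysis.Analysis" "HOL-Library.Extended"
begin

text \<open>
  The ambient metric space \<open>X\<close> is the carrier \<open>UNIV\<close> of a type of class \<open>metric_space\<close>.
\<close>

section \<open>Aspect ratio and minimized expansion constant\<close>

definition d_min :: "'a::metric_space set \<Rightarrow> real" where
  "d_min R = Min {dist p q | p q. p \<in> R \<and> q \<in> R \<and> p \<noteq> q}"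

text \<open>
  On a singleton \<open>R\<close> the value \<open>d_min R\<close> is unspecified, but \<open>aspect_ratio R = 0\<close> because
  \<open>diameter R = 0\<close>.
\<close>

definition aspect_ratio :: "'a::metric_space set \<Rightarrow> real" where
  "aspect_ratio R = diameter R / d_min R"

definition locally_finite_set :: "'a::metric_space set \<Rightarrow> bool" where
  "locally_finite_set A \<longleftrightarrow> (\<forall>p. \<forall>t\<ge>0. finite (cball p t \<inter> A))"

text \<open>
  The supremum may be infinite for some \<open>A\<close>, so it is taken in \<open>ereal\<close>. The infimum grows as
  \<open>\<xi>\<close> decreases to \<open>0\<close>, so the limit always exists there.
\<close>

definition minimized_expansion_constant :: "'a::metric_space set \<Rightarrow> ereal" where
  "minimized_expansion_constant R =
     Lim (at_right (0::real)) (\<lambda>\<xi>.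
       INF A \<in> {A. R \<subseteq> A \<and> locally_finite_set A}.
         SUP (p, t) \<in> A \<times> {\<xi><..}.
           ereal (real (card (cball p (2 * t) \<inter> A)) / real (card (cball p t \<inter> A))))"


section \<open>Compressed cover trees\<close>

text \<open>
  The type of levels is a parameter: it is \<open>int\<close> for compressed cover trees, and \<open>int extended\<close>
  while a tree is being built, when the root has level \<open>Pinf\<close>. The value of \<open>parent\<close> is
  meaningful only on nodes other than the root, that of \<open>level\<close> only on nodes.
\<close>

record ('a, 'l) levelled_tree =
  nodes :: "'a set"
  root_node :: 'a
  parent :: "'a \<Rightarrow> 'a"
  level :: "'a \<Rightarrow> 'l"

definition children :: "('a, 'l) levelled_tree \<Rightarrow> 'a \<Rightarrow> 'a set" where
  "children T q = {a \<in> nodes T - {root_node T}. parent T a = q}"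

definition rooted_tree :: "('a, 'l) levelled_tree \<Rightarrow> bool" where
  "rooted_tree T \<longleftrightarrow>
     root_node T \<in> nodes T \<and>
     (\<forall>q \<in> nodes T - {root_node T}. parent T q \<in> nodes T) \<and>
     (\<forall>q \<in> nodes T. \<exists>n. (parent T ^^ n) q = root_node T)"

definition cover_set :: "('a, int) levelled_tree \<Rightarrow> int \<Rightarrow> 'a set" where
  "cover_set T i = {p \<in> nodes T. level T p \<ge> i}"

definition compressed_cover_tree ::
  "'a::metric_space set \<Rightarrow> ('a, int) levelled_tree \<Rightarrow> bool" where
  "compressed_cover_tree R T \<longleftrightarrow>
     finite R \<and> nodes T = R \<and> rooted_tree T \<and>
     (\<forall>p \<in> R - {root_node T}. level T (root_node T) \<ge> 1 + level T p) \<and>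
     (\<forall>q \<in> R - {root_node T}.
        dist q (parent T q) \<le> 2 powi (level T q + 1) \<and> level T q < level T (parent T q)) \<and>
     (\<forall>i. \<forall>p \<in> cover_set T i. \<forall>q \<in> cover_set T i. p \<noteq> q \<longrightarrow> dist p q > 2 powi i)"


section \<open>The algorithm\<close>

text \<open>
  Every procedure returns its result together with the number of unit-cost operations performed.
  It returns \<open>None\<close> exactly when its loop does not terminate.
\<close>

type_synonym 'a partial_tree = "('a, int extended) levelled_tree"

type_synonym 'a dictionary = "int extended \<Rightarrow> 'a set option"

definition finite_levels :: "'a partial_tree \<Rightarrow> 'a set \<Rightarrow> int set" where
  "finite_levels T A = {j. \<exists>a \<in> A. level T a = Fin j}"

definition min_level :: "'a partial_tree \<Rightarrow> int" where
  "min_level T = Min (finite_levels T (nodes T))"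

definition max_nonroot_level :: "'a partial_tree \<Rightarrow> int" where
  "max_nonroot_level T = Max (finite_levels T (nodes T - {root_node T}))"

definition next_level :: "'a partial_tree \<Rightarrow> 'a \<Rightarrow> int \<Rightarrow> int" where
  "next_level T a i =
     (let J = {j \<in> finite_levels T (children T a - {a}). j < i}
      in if J = {} then min_level T - 1 else Max J)"

text \<open>
  The while loop of \<open>AddPoint\<close>, in state \<open>i\<close>, \<open>i\<^sup>+ = ip\<close>, \<open>M\<close>, where \<open>R\<^bsub>i\<^sup>+\<^esub>\<close> is the dictionary
  entry at \<open>ip\<close> and \<open>n\<close> counts the operations performed so far.

  One round costs: the loop test; one access to the group of children at level \<open>i\<close> for each
  element of \<open>R\<^bsub>i\<^sup>+\<^esub>\<close>; the listing of each element of \<open>\<C>\<^sub>i\<close>, its distance to \<open>p\<close> and one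
  comparison; the storing of \<open>R\<^sub>i\<close> and its emptiness test. If the loop goes on, add for each
  element of \<open>R\<^sub>i\<close> one passage to its next level and one comparison for the maximum, and finally
  two assignments.
\<close>

partial_function (option) descend ::
  "'a::metric_space partial_tree \<Rightarrow> 'a \<Rightarrow> int \<Rightarrow> int extended \<Rightarrow> 'a dictionary \<Rightarrow> nat
     \<Rightarrow> ('a dictionary \<times> nat) option" where
  "descend T p i ip M n =
     (if i < min_level T then Some (M, n + 1)
      else
        let Rip = the (M ip);
            Ci = Rip \<union> {a. \<exists>q \<in> Rip. a \<in> children T q \<and> level T a = Fin i};
            Ri = {a \<in> Ci. dist p a \<le> 2 powi (i + 1)};
            M' = M(Fin i \<mapsto> Ri);
            n' = n + 1 + card Rip + 3 * card Ci + 2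
        in if Ri = {} then Some (M', n')
           else descend T p (Max ((\<lambda>a. next_level T a i) ` Ri)) (Fin i) M' (n' + 2 * card Ri + 2))"

text \<open>
  The test \<open>d(p, S) \<le> 2\<^sup>k\<close>. The explicit nonemptiness is needed since \<open>infdist p {} = 0\<close>. The key
  \<open>Minf\<close> never occurs.
\<close>

fun near :: "'a::metric_space \<Rightarrow> int extended \<Rightarrow> 'a set \<Rightarrow> bool" where
  "near p (Fin i) S \<longleftrightarrow> S \<noteq> {} \<and> infdist p S \<le> 2 powi i"
| "near p Pinf S \<longleftrightarrow> True"
| "near p Minf S \<longleftrightarrow> False"

definition attach :: "'a partial_tree \<Rightarrow> 'a \<Rightarrow> 'a \<Rightarrow> int \<Rightarrow> 'a partial_tree" where
  "attach T p q x = T\<lparr>nodes := insert p (nodes T), parent := (parent T)(p := q),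
                      level := (level T)(p := Fin x)\<rparr>"

text \<open>
  The nearest element is chosen by \<open>ch p\<close> from the set of all nearest elements. A point is
  added at most once, so a choice function depending on the point covers every way of breaking
  ties.

  The cost consists of: storing \<open>R\<^bsub>+\<infinity>\<^esub>\<close> and testing \<open>W = {r}\<close>; finding the first \<open>i\<close>, which is the
  top child level of the root, and setting \<open>i\<close> and \<open>i\<^sup>+\<close>; the loop; for each key visited, the
  access to its set and the test, with one distance and one comparison per element; the choice of
  \<open>q\<close>, again with one distance and one comparison per element; the computation of \<open>x\<close>; a walk
  through the levels of the children of \<open>q\<close> to the place of \<open>x\<close>; the recording of \<open>p\<close>, its parent
  and its level, and the update of the minimum level.
\<close>

definition add_point ::
  "('a \<Rightarrow> 'a set \<Rightarrow> 'a) \<Rightarrow> 'a::metric_space partial_tree \<Rightarrow> 'a \<Rightarrow> ('a partial_tree \<times> nat) option" where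
  "add_point ch T p =
     (let M0 = [Pinf \<mapsto> {root_node T}]
      in case (if nodes T = {root_node T} then Some (M0, 2)
               else descend T p (max_nonroot_level T) Pinf M0 5) of
           None \<Rightarrow> None
         | Some (M, n) \<Rightarrow>
             let k = Min {k \<in> dom M. near p k (the (M k))};
                 S = the (M k);
                 q = ch p {q \<in> S. dist p q = infdist p S};
                 x = (GREATEST x. dist p q > 2 powi x)
             in Some (attach T p q x,
                  n + (\<Sum>j \<in> {j \<in> dom M. j \<le> k}. 2 + 2 * card (the (M j)))
                    + 2 * card S + 1
                    + card (finite_levels T (children T q)) + 4))"

fun add_points ::
  "('a \<Rightarrow> 'a set \<Rightarrow> 'a) \<Rightarrow> 'a::metric_space partial_tree \<Rightarrow> 'a list \<Rightarrow> ('a partial_tree \<times> nat) option" where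
  "add_points ch T [] = Some (T, 0)"
| "add_points ch T (p # ps) =
     (case add_point ch T p of
        None \<Rightarrow> None
      | Some (T', n) \<Rightarrow>
          (case add_points ch T' ps of
             None \<Rightarrow> None
           | Some (T'', m) \<Rightarrow> Some (T'', n + m + 1)))"

definition initial_tree :: "'a \<Rightarrow> 'a partial_tree" where
  "initial_tree r = \<lparr>nodes = {r}, root_node = r, parent = (\<lambda>_. r), level = (\<lambda>_. Pinf)\<rparr>"

text \<open>If the root is the only node, this gives it some unspecified integer level.\<close>

definition set_root_level :: "'a partial_tree \<Rightarrow> ('a, int) levelled_tree" where
  "set_root_level T =
     \<lparr>nodes = nodes T, root_node = root_node T, parent = parent T,
      level = (\<lambda>a. if a = root_node T then 1 + max_nonroot_level T
                   else (case level T a of Fin j \<Rightarrow> j))\<rparr>"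

text \<open>
  The list \<open>ps\<close> is the order in which the points other than the root \<open>r\<close> are added. Creating the
  initial tree and setting the final level of the root cost \<open>1 + 2\<close>.
\<close>

definition build_tree ::
  "('a \<Rightarrow> 'a set \<Rightarrow> 'a) \<Rightarrow> 'a::metric_space \<Rightarrow> 'a list \<Rightarrow> (('a, int) levelled_tree \<times> nat) option" where
  "build_tree ch r ps =
     (case add_points ch (initial_tree r) ps of
        None \<Rightarrow> None
      | Some (T, n) \<Rightarrow> Some (set_root_level T, n + 3))"

end

theory Submission
  imports Defs
begin

text \<open>
  Along the descent for \<open>p\<close>, the set computed at a visited level \<open>i\<close> is exactly the part of the
  cover set at level \<open>i\<close> within distance \<open>2 powi (i + 1)\<close> of \<open>p\<close>, and every node \<open>w\<close> with
  \<open>dist p w \<le> 2 powi (level w + 1)\<close> has its level visited. The second fact yields the separation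
  condition for the new node: a node too close to \<open>p\<close> would be a candidate at the chosen key, hence
  no closer to \<open>p\<close> than the chosen parent.

  For the running time, the candidate sets and the groups of children at one level are
  \<open>2 powi i\<close>-separated subsets of a ball of radius \<open>2 powi (i + 1)\<close>, so they have at most
  \<open>c_m ^ 4\<close> elements and a round costs \<open>O(c_m ^ 8)\<close>. Every finite level \<open>j\<close> satisfies
  \<open>d_min R \<le> 2 powi (j + 1)\<close> and \<open>2 powi j < diameter R\<close>, which bounds the number of rounds by
  \<open>log 2 (aspect_ratio R) + 2\<close>.
\<close>

section \<open>Powers of two and distances in finite sets\<close>

lemma two_powi_le_iff [simp]: "(2::real) powi m \<le> 2 powi n \<longleftrightarrow> m \<le> n"
  by (metis not_le power_int_increasing power_int_strict_increasing one_le_numeral one_less_numeral_iff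
      semiring_norm(76))

lemma two_powi_less_iff [simp]: "(2::real) powi m < 2 powi n \<longleftrightarrow> m < n"
  by (simp add: linorder_not_le [symmetric])

lemma two_powi_plus_one: "(2::real) powi (m + 1) = 2 * 2 powi m"
  by (simp add: power_int_add_1')

lemma two_powi_eq_powr: "(2::real) powi m = 2 powr real_of_int m"
  by (simp add: powr_real_of_int')

text \<open>For an integer, being admissible means lying strictly below \<open>log 2 d\<close>, so
  the maximum is the ceiling of that logarithm minus one. The first bound serves the separation of a
  new node, the second its distance to the parent.\<close>

lemma Greatest_two_powi_less:
  fixes d :: real
  assumes "0 < d"
  defines "x \<equiv> (GREATEST x::int. 2 powi x < d)"
  shows "2 powi x < d" and "d \<le> 2 powi (x + 1)"
proof -
  have less_iff: "2 powi y < d \<longleftrightarrow> real_of_int y < log 2 d" for y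
    using assms(1) by (simp add: two_powi_eq_powr less_log_iff)
  have "x = \<lceil>log 2 d\<rceil> - 1"
    unfolding x_def less_iff
  proof (rule Greatest_equality)
    show "real_of_int (\<lceil>log 2 d\<rceil> - 1) < log 2 d"
      by linarith
    show "y \<le> \<lceil>log 2 d\<rceil> - 1" if "real_of_int y < log 2 d" for y
      using that by linarith
  qed
  then have x: "real_of_int x < log 2 d" "\<not> real_of_int (x + 1) < log 2 d"
    by linarith+
  show "2 powi x < d"
    using x(1) less_iff by blast
  show "d \<le> 2 powi (x + 1)"
    using x(2) less_iff[of "x + 1"] by linarith
qed

lemma d_min_pos_le:
  assumes "finite R" "p \<in> R" "q \<in> R" "p \<noteq> q"
  shows "0 < d_min R \<and> d_min R \<le> dist p q"
proof -
  define D where "D = {dist p q |p q. p \<in> R \<and> q \<in> R \<and> p \<noteq> q}"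
  have "D \<subseteq> (\<lambda>(p, q). dist p q) ` (R \<times> R)"
    by (auto simp: D_def)
  then have "finite D"
    using assms(1) by (meson finite_SigmaI finite_imageI finite_subset)
  moreover have "dist p q \<in> D"
    using assms by (auto simp: D_def)
  ultimately have "d_min R \<in> D" "d_min R \<le> dist p q"
    unfolding d_min_def D_def[symmetric] by (auto intro: Min_in Min_le)
  then show ?thesis
    by (auto simp: D_def)
qed

lemma infdist_attained_finite:
  assumes "finite S" "S \<noteq> {}"
  shows "\<exists>q\<in>S. dist p q = infdist p S"
proof -
  have "Inf (dist p ` S) = Min (dist p ` S)"
    using assms by (intro cInf_eq_Min) auto
  also have "\<dots> \<in> dist p ` S"
    using assms by (intro Min_in) auto
  finally have "infdist p S \<in> dist p ` S"
    using assms(2) by (simp add: infdist_notempty)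
  then show ?thesis
    by force
qed


section \<open>Packing in terms of the minimized expansion constant\<close>

text \<open>The inner supremum and infimum get names so that the limit can be treated as that of a
  monotone function of \<xi>.\<close>

definition expansion_sup :: "'a::metric_space set \<Rightarrow> real \<Rightarrow> ereal" where
  "expansion_sup A \<xi> = (SUP (p, t) \<in> A \<times> {\<xi><..}.
     ereal (real (card (cball p (2 * t) \<inter> A)) / real (card (cball p t \<inter> A))))"

definition expansion_inf :: "'a::metric_space set \<Rightarrow> real \<Rightarrow> ereal" where
  "expansion_inf R \<xi> = (INF A \<in> {A. R \<subseteq> A \<and> locally_finite_set A}. expansion_sup A \<xi>)"

lemma expansion_inf_antimono:
  assumes "\<xi> \<le> \<eta>"
  shows "expansion_inf R \<eta> \<le> expansion_inf R \<xi>"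
  unfolding expansion_inf_def expansion_sup_def using assms
  by (intro INF_mono') (auto intro!: SUP_subset_mono)

text \<open>An antitone function of \<xi> has its supremum as right limit at 0. In this form the
  constant can be compared with single values of \<xi>, without limits.\<close>

lemma minimized_expansion_constant_eq_SUP:
  "minimized_expansion_constant R = (SUP \<xi>\<in>{0<..}. expansion_inf R \<xi>)"
proof -
  have "(expansion_inf R \<longlongrightarrow> (SUP \<xi>\<in>{0<..}. expansion_inf R \<xi>)) (at_right 0)"
  proof (rule order_tendstoI)
    fix a assume "a < (SUP \<xi>\<in>{0<..}. expansion_inf R \<xi>)"
    then obtain \<eta> where \<eta>: "0 < \<eta>" "a < expansion_inf R \<eta>"
      by (auto simp: less_SUP_iff)
    then have "a < expansion_inf R \<xi>" if "\<xi> < \<eta>" for \<xi>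
      using expansion_inf_antimono[of \<xi> \<eta> R] that by (meson less_imp_le less_le_trans)
    then show "\<forall>\<^sub>F \<xi> in at_right 0. a < expansion_inf R \<xi>"
      using \<eta>(1) by (auto simp: eventually_at_right_field)
  next
    fix a assume a: "(SUP \<xi>\<in>{0<..}. expansion_inf R \<xi>) < a"
    have "expansion_inf R \<xi> < a" if "0 < \<xi>" for \<xi>
      using a that by (meson SUP_lessD greaterThan_iff)
    then show "\<forall>\<^sub>F \<xi> in at_right 0. expansion_inf R \<xi> < a"
      by (auto simp: eventually_at_right_field intro: exI[of _ 1])
  qed
  then show ?thesis
    unfolding minimized_expansion_constant_def expansion_inf_def expansion_sup_def
    by (intro tendsto_Lim) simp_all
qed

lemma card_cball_Int_pos:
  assumes "locally_finite_set A" "p \<in> A" "0 \<le> t"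
  shows "0 < card (cball p t \<inter> A)"
proof -
  have "p \<in> cball p t \<inter> A" "finite (cball p t \<inter> A)"
    using assms by (simp_all add: locally_finite_set_def)
  then show ?thesis
    by (metis card_gt_0_iff empty_iff)
qed

text \<open>A ball lies in its double, so the ratios are at least 1. A single \<xi> suffices because
  the constant is a supremum.\<close>

lemma minimized_expansion_constant_ge_1:
  assumes "R \<noteq> {}"
  shows "1 \<le> minimized_expansion_constant R"
proof -
  have "1 \<le> expansion_sup A 1" if A: "R \<subseteq> A" "locally_finite_set A" for A
  proof -
    obtain p where p: "p \<in> A"
      using assms A(1) by auto
    have fin: "finite (cball p 4 \<inter> A)"
      using A(2) by (simp add: locally_finite_set_def)
    have "card (cball p 2 \<inter> A) \<le> card (cball p 4 \<inter> A)"
      by (intro card_mono fin) auto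
    then have "1 \<le> ereal (real (card (cball p (2 * 2) \<inter> A)) / real (card (cball p 2 \<inter> A)))"
      using card_cball_Int_pos[OF A(2) p, of 2] by (simp add: one_ereal_def)
    also have "\<dots> \<le> expansion_sup A 1"
      unfolding expansion_sup_def using p by (intro SUP_upper2[of "(p, 2)"]) auto
    finally show ?thesis .
  qed
  then have "1 \<le> expansion_inf R 1"
    unfolding expansion_inf_def by (auto intro: INF_greatest)
  also have "\<dots> \<le> minimized_expansion_constant R"
    unfolding minimized_expansion_constant_eq_SUP by (intro SUP_upper) auto
  finally show ?thesis .
qed

text \<open>The set \<open>R\<close> is itself admissible as \<open>A\<close>, and denominators are
  at least 1. This makes the constant finite, hence a real number.\<close>

lemma minimized_expansion_constant_le_card:
  assumes "finite R"
  shows "minimized_expansion_constant R \<le> ereal (real (card R))"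
  unfolding minimized_expansion_constant_eq_SUP
proof (rule SUP_least)
  fix \<xi> :: real assume "\<xi> \<in> {0<..}"
  have "expansion_inf R \<xi> \<le> expansion_sup R \<xi>"
    unfolding expansion_inf_def using assms
    by (intro INF_lower) (auto simp: locally_finite_set_def)
  also have "\<dots> \<le> ereal (real (card R))"
    unfolding expansion_sup_def
  proof (rule SUP_least, clarify)
    fix p t assume p: "p \<in> R" "\<xi> < t"
    have "p \<in> cball p t \<inter> R"
      using p \<open>\<xi> \<in> {0<..}\<close> by auto
    then have "card (cball p t \<inter> R) > 0"
      using assms by (metis card_gt_0_iff empty_iff finite_Int)
    moreover have "card (cball p (2 * t) \<inter> R) \<le> card R"
      using assms by (intro card_mono) auto
    ultimately have "card (cball p (2 * t) \<inter> R) \<le> card R * card (cball p t \<inter> R)"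
      by (metis Suc_leI One_nat_def le_trans mult.right_neutral mult_le_mono2)
    with \<open>card (cball p t \<inter> R) > 0\<close>
    show "ereal (real (card (cball p (2 * t) \<inter> R)) / real (card (cball p t \<inter> R)))
        \<le> ereal (real (card R))"
      by (simp add: divide_le_eq flip: of_nat_mult)
  qed
  finally show "expansion_inf R \<xi> \<le> ereal (real (card R))" .
qed

text \<open>The infimum over \<open>A\<close> need not be attained, so a strict bound is what yields
  a witness. The witness depends on \<xi>, so the radii of interest must be fixed
  beforehand.\<close>

lemma obtain_doubling_superset:
  assumes "minimized_expansion_constant R < ereal c" "0 < \<xi>"
  obtains A where "R \<subseteq> A" "locally_finite_set A"
    "\<And>p t. p \<in> A \<Longrightarrow> \<xi> < t \<Longrightarrow>
       real (card (cball p (2 * t) \<inter> A)) \<le> c * real (card (cball p t \<inter> A))"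
proof -
  have "expansion_inf R \<xi> < ereal c"
    using assms unfolding minimized_expansion_constant_eq_SUP
    by (meson SUP_lessD greaterThan_iff)
  then obtain A where A: "R \<subseteq> A" "locally_finite_set A" "expansion_sup A \<xi> < ereal c"
    by (auto simp: expansion_inf_def INF_less_iff)
  have "real (card (cball p (2 * t) \<inter> A)) \<le> c * real (card (cball p t \<inter> A))"
    if pt: "p \<in> A" "\<xi> < t" for p t
  proof -
    have "ereal (real (card (cball p (2 * t) \<inter> A)) / real (card (cball p t \<inter> A))) \<le> expansion_sup A \<xi>"
      unfolding expansion_sup_def using pt by (intro SUP_upper2[of "(p, t)"]) auto
    with A(3) have "ereal (real (card (cball p (2 * t) \<inter> A)) / real (card (cball p t \<inter> A))) < ereal c"
      by (rule le_less_trans[rotated])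
    with card_cball_Int_pos[OF A(2) pt(1), of t] pt(2) assms(2) show ?thesis
      by (simp add: divide_less_eq)
  qed
  with A show ?thesis
    using that by blast
qed

text \<open>
  The balls of radius \<open>\<delta>\<close> around the points of \<open>S\<close> are disjoint and lie in the ball of radius
  \<open>16 * \<delta>\<close> around the point of \<open>S\<close> whose ball of radius \<open>\<delta>\<close> has the fewest points.
\<close>

lemma card_separated_less:
  fixes S :: "'a::metric_space set"
  assumes c: "minimized_expansion_constant R < ereal c"
    and S: "finite S" "S \<subseteq> R" "S \<subseteq> cball p (4 * \<delta>)" and "0 < \<delta>"
    and sep: "\<And>x y. x \<in> S \<Longrightarrow> y \<in> S \<Longrightarrow> x \<noteq> y \<Longrightarrow> 2 * \<delta> < dist x y"
  shows "real (card S) \<le> c ^ 4"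
proof (cases "S = {}")
  case False
  \<comment> \<open>Doubling is applied at the radii \<delta>, 2\<delta>, 4\<delta> and 8\<delta>,
    all above \<delta>/2.\<close>
  obtain A where A: "R \<subseteq> A" "locally_finite_set A" and
    dbl: "\<And>p t. p \<in> A \<Longrightarrow> \<delta> / 2 < t \<Longrightarrow>
       real (card (cball p (2 * t) \<inter> A)) \<le> c * real (card (cball p t \<inter> A))"
    using obtain_doubling_superset[OF c, of "\<delta> / 2"] \<open>0 < \<delta>\<close> by auto
  define N where "N q t = card (cball q t \<inter> A)" for q t
  obtain q where q: "q \<in> S" "\<And>x. x \<in> S \<Longrightarrow> N q \<delta> \<le> N x \<delta>"
    using ex_min_if_finite[of "(\<lambda>x. N x \<delta>) ` S"] S(1) False
    by (metis (mono_tags, lifting) arg_min_if_finite(1) arg_min_least)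
  have qA: "q \<in> A"
    using q(1) S(2) A(1) by auto
  have Npos: "0 < N q t" if "0 \<le> t" for t
    unfolding N_def using card_cball_Int_pos[OF A(2) qA that] .
  have cpos: "0 < c"
  proof -
    have "0 < c * real (N q \<delta>)"
      using dbl[OF qA, of \<delta>] Npos[of "2 * \<delta>"] \<open>0 < \<delta>\<close> by (simp add: N_def)
    then show ?thesis
      using Npos[of \<delta>] \<open>0 < \<delta>\<close> by (simp add: zero_less_mult_iff)
  qed
  have fin: "finite (cball x t \<inter> A)" if "0 \<le> t" for x t
    using A(2) that by (simp add: locally_finite_set_def)
  have "card S * N q \<delta> = (\<Sum>x\<in>S. N q \<delta>)"
    by simp
  also have "\<dots> \<le> (\<Sum>x\<in>S. N x \<delta>)"
    by (intro sum_mono q(2))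
  also have "\<dots> = card (\<Union>x\<in>S. cball x \<delta> \<inter> A)"
    unfolding N_def
  proof (rule card_UN_disjoint[symmetric])
    show "\<forall>x\<in>S. \<forall>y\<in>S. x \<noteq> y \<longrightarrow> cball x \<delta> \<inter> A \<inter> (cball y \<delta> \<inter> A) = {}"
    proof (intro ballI impI)
      fix x y assume "x \<in> S" "y \<in> S" "x \<noteq> y"
      then have "2 * \<delta> < dist x y"
        by (rule sep)
      then have "cball x \<delta> \<inter> cball y \<delta> = {}"
        by (auto simp: disjoint_iff) (smt (verit) dist_triangle2 dist_commute)
      then show "cball x \<delta> \<inter> A \<inter> (cball y \<delta> \<inter> A) = {}"
        by auto
    qed
  qed (use S(1) fin \<open>0 < \<delta>\<close> in auto)
  also have "\<dots> \<le> N q (16 * \<delta>)"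
    unfolding N_def
  proof (rule card_mono)
    show "finite (cball q (16 * \<delta>) \<inter> A)"
      using fin \<open>0 < \<delta>\<close> by simp
    show "(\<Union>x\<in>S. cball x \<delta> \<inter> A) \<subseteq> cball q (16 * \<delta>) \<inter> A"
    proof clarsimp
      fix x y assume x: "x \<in> S" and y: "dist x y \<le> \<delta>"
      have "dist p q \<le> 4 * \<delta>" "dist p x \<le> 4 * \<delta>"
        using x q(1) S(3) by auto
      \<comment> \<open>The triangle inequality gives 9\<delta>; the next power of two, 16, is
        reached by four doublings.\<close>
      then show "dist q y \<le> 16 * \<delta>"
        using y \<open>0 < \<delta>\<close> dist_triangle[of q y x] dist_triangle[of q x p] by (simp add: dist_commute)
    qed
  qed
  finally have "real (card S) * N q \<delta> \<le> N q (16 * \<delta>)"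
    by (metis of_nat_le_iff of_nat_mult)
  also have "\<dots> \<le> c * N q (8 * \<delta>)"
    using dbl[OF qA, of "8 * \<delta>"] \<open>0 < \<delta>\<close> by (simp add: N_def)
  also have "\<dots> \<le> c * (c * N q (4 * \<delta>))"
    using dbl[OF qA, of "4 * \<delta>"] \<open>0 < \<delta>\<close> cpos by (simp add: N_def)
  also have "\<dots> \<le> c * (c * (c * N q (2 * \<delta>)))"
    using dbl[OF qA, of "2 * \<delta>"] \<open>0 < \<delta>\<close> cpos by (simp add: N_def)
  also have "\<dots> \<le> c * (c * (c * (c * N q \<delta>)))"
    using dbl[OF qA, of "\<delta>"] \<open>0 < \<delta>\<close> cpos by (simp add: N_def)
  also have "\<dots> = c ^ 4 * N q \<delta>"
    by (simp add: power4_eq_xxxx)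
  finally show ?thesis
    using Npos[of \<delta>] \<open>0 < \<delta>\<close> by simp
qed (use zero_le_even_power[of 4 c] in simp)

text \<open>Letting \<open>c'\<close> decrease to the constant removes the strictness. The choice
  \<delta> = \<open>2 powi (i - 1)\<close> turns separation 2\<delta> and radius 4\<delta> into
  consecutive powers of two.\<close>

lemma card_separated_le:
  fixes S :: "'a::metric_space set"
  assumes c: "minimized_expansion_constant R = ereal c"
    and S: "finite S" "S \<subseteq> R" "S \<subseteq> cball p (2 powi (i + 1))"
    and sep: "\<And>x y. x \<in> S \<Longrightarrow> y \<in> S \<Longrightarrow> x \<noteq> y \<Longrightarrow> 2 powi i < dist x y"
  shows "real (card S) \<le> c ^ 4"
proof (rule tendsto_lowerbound)
  show "((\<lambda>c. c ^ 4) \<longlongrightarrow> c ^ 4) (at_right c)"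
    by (intro tendsto_intros)
  have "2 powi i = 2 * (2 powi (i - 1) :: real)"
    using two_powi_plus_one[of "i - 1"] by simp
  then have "real (card S) \<le> c' ^ 4" if "c < c'" for c'
    using card_separated_less[of R c' S p "2 powi (i - 1)"] c S sep that
    by (simp add: two_powi_plus_one)
  then show "\<forall>\<^sub>F c' in at_right c. real (card S) \<le> c' ^ 4"
    by (auto simp: eventually_at_right_field intro: exI[of _ "c + 1"])
qed simp


section \<open>Partially built trees\<close>

text \<open>The invariant between two insertions. Fixing the parent of the root makes
  \<open>parent T\<close> a self-map of the nodes, so its iterates never leave the tree. The root at
  level \<open>Pinf\<close> takes part in the separation at every \<open>i\<close>.\<close>

locale partial_cover_tree =
  fixes T :: "'a::metric_space partial_tree"
  assumes finite_nodes: "finite (nodes T)"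
    and root_in_nodes: "root_node T \<in> nodes T"
    and parent_root: "parent T (root_node T) = root_node T"
    and level_root: "level T (root_node T) = Pinf"
    and parent_in_nodes: "q \<in> nodes T \<Longrightarrow> parent T q \<in> nodes T"
    and reaches_root: "q \<in> nodes T \<Longrightarrow> \<exists>n. (parent T ^^ n) q = root_node T"
    and level_nonroot: "q \<in> nodes T - {root_node T} \<Longrightarrow> \<exists>j. level T q = Fin j"
    and level_less_parent: "q \<in> nodes T - {root_node T} \<Longrightarrow> level T q < level T (parent T q)"
    and dist_parent_le: "q \<in> nodes T - {root_node T} \<Longrightarrow> level T q = Fin j \<Longrightarrow>
          dist q (parent T q) \<le> 2 powi (j + 1)"
    and separated: "p \<in> nodes T \<Longrightarrow> q \<in> nodes T \<Longrightarrow> p \<noteq> q \<Longrightarrow>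
          Fin i \<le> level T p \<Longrightarrow> Fin i \<le> level T q \<Longrightarrow> 2 powi i < dist p q"
begin

text \<open>
  The set \<open>R\<^sub>k\<close> of the algorithm, described without reference to the run.
\<close>

fun candidates :: "'a \<Rightarrow> int extended \<Rightarrow> 'a set" where
  "candidates p (Fin i) = {a \<in> nodes T. Fin i \<le> level T a \<and> dist p a \<le> 2 powi (i + 1)}"
| "candidates p Pinf = {root_node T}"
| "candidates p Minf = {}"

section \<open>Elementary facts on candidates and levels\<close>

lemma candidates_subset: "candidates p k \<subseteq> nodes T"
  using root_in_nodes by (cases k) auto

lemma finite_candidates: "finite (candidates p k)"
  using candidates_subset finite_nodes by (rule finite_subset)

lemma candidates_level: "q \<in> candidates p k \<Longrightarrow> k \<le> level T q"
  using level_root by (cases k) auto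

lemma level_eq_Fin_imp_nonroot: "q \<in> nodes T \<Longrightarrow> level T q = Fin j \<Longrightarrow> q \<in> nodes T - {root_node T}"
  using level_root by auto

lemma finite_finite_levels:
  assumes "A \<subseteq> nodes T"
  shows "finite (finite_levels T A)"
proof -
  have "finite_levels T A \<subseteq> (\<lambda>a. case level T a of Fin j \<Rightarrow> j | _ \<Rightarrow> 0) ` A"
    by (force simp: finite_levels_def)
  then show ?thesis
    using assms finite_nodes by (meson finite_imageI finite_subset)
qed

lemma children_subset: "children T a \<subseteq> nodes T"
  by (auto simp: children_def)

lemma finite_child_levels: "finite (finite_levels T (children T a - B))"
  using children_subset[of a] by (intro finite_finite_levels) auto

lemma min_level_le:
  assumes "a \<in> nodes T" "level T a = Fin j"
  shows "min_level T \<le> j"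
  unfolding min_level_def using assms finite_finite_levels[OF order_refl]
  by (intro Min_le) (auto simp: finite_levels_def)

lemma le_max_nonroot_level:
  assumes "a \<in> nodes T" "level T a = Fin j"
  shows "j \<le> max_nonroot_level T"
  unfolding max_nonroot_level_def
  using level_eq_Fin_imp_nonroot[OF assms] assms(2) finite_finite_levels[of "nodes T - {root_node T}"]
  by (intro Max_ge) (auto simp: finite_levels_def)

text \<open>A node other than the root has a finite level, so the minimum and maximum are taken over
  nonempty sets.\<close>

lemma extremal_level_attained:
  assumes "nodes T \<noteq> {root_node T}"
  shows "\<exists>a\<in>nodes T. level T a = Fin (min_level T)"
    and "\<exists>a\<in>nodes T. level T a = Fin (max_nonroot_level T)"
proof -
  obtain q where q: "q \<in> nodes T - {root_node T}"
    using assms root_in_nodes by auto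
  with level_nonroot obtain j where j: "level T q = Fin j"
    by blast
  have "min_level T \<in> finite_levels T (nodes T)"
    unfolding min_level_def using q j finite_finite_levels[OF order_refl]
    by (intro Min_in) (auto simp: finite_levels_def)
  then show "\<exists>a\<in>nodes T. level T a = Fin (min_level T)"
    by (auto simp: finite_levels_def)
  have "max_nonroot_level T \<in> finite_levels T (nodes T - {root_node T})"
    unfolding max_nonroot_level_def using q j finite_finite_levels[of "nodes T - {root_node T}"]
    by (intro Max_in) (auto simp: finite_levels_def)
  then show "\<exists>a\<in>nodes T. level T a = Fin (max_nonroot_level T)"
    by (auto simp: finite_levels_def)
qed

text \<open>The strict decrease makes the descent terminate. The default value
  \<open>min_level T - 1\<close> is below \<open>i\<close> by the hypothesis.\<close>

lemma next_level_bounds: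
  assumes "min_level T \<le> i"
  shows "min_level T - 1 \<le> next_level T a i" "next_level T a i < i"
proof -
  define J where "J = {j \<in> finite_levels T (children T a - {a}). j < i}"
  have fin: "finite J"
    unfolding J_def by (simp add: finite_child_levels)
  have nl: "next_level T a i = (if J = {} then min_level T - 1 else Max J)"
    unfolding next_level_def J_def Let_def ..
  have Max: "min_level T \<le> Max J \<and> Max J < i" if "J \<noteq> {}"
    using Max_in[OF fin that] min_level_le children_subset[of a]
    by (auto simp: J_def finite_levels_def)
  show "min_level T - 1 \<le> next_level T a i"
    using Max unfolding nl by (cases "J = {}") auto
  show "next_level T a i < i"
    using assms Max unfolding nl by (cases "J = {}") auto
qed

text \<open>No child level is skipped: removing \<open>a\<close> from its own children loses
  nothing, since a child lies strictly below its parent.\<close>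

lemma le_next_level:
  assumes "b \<in> children T a" "level T b = Fin j" "j < i"
  shows "j \<le> next_level T a i"
proof -
  define J where "J = {j \<in> finite_levels T (children T a - {a}). j < i}"
  have fin: "finite J"
    unfolding J_def by (simp add: finite_child_levels)
  have "b \<noteq> a"
    using level_less_parent[of b] assms(1) by (auto simp: children_def)
  then have "j \<in> J"
    using assms by (auto simp: J_def finite_levels_def)
  then show ?thesis
    using Max_ge[OF fin] by (auto simp: next_level_def J_def[symmetric])
qed

text \<open>
  Climbing from a node \<open>w\<close> with \<open>dist p w \<le> 2 powi (level + 1)\<close> keeps this inequality, since the
  distance to the parent is at most \<open>2 powi (level + 1)\<close> and the level increases. Hence the last
  ancestor below level \<open>k\<close> has its parent among the candidates at \<open>k\<close>.
\<close>

lemma obtain_ancestor: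
  assumes w: "w \<in> nodes T" "level T w = Fin j" "dist p w \<le> 2 powi (j + 1)" "Fin j < k"
  obtains b j' where "b \<in> children T (parent T b)" "parent T b \<in> candidates p k"
    "level T b = Fin j'" "Fin j' < k" "j \<le> j'" "j' = j \<Longrightarrow> b = w"
proof -
  \<comment> \<open>Instead of an explicit chain of ancestors, a node of greatest level with this
    property is taken. The last conjunct records that staying at level \<open>j\<close> means not
    having left \<open>w\<close>.\<close>
  define P where "P b j' \<longleftrightarrow> b \<in> nodes T \<and> level T b = Fin j' \<and> Fin j' < k \<and>
    dist p b \<le> 2 powi (j' + 1) \<and> j \<le> j' \<and> (j' = j \<longrightarrow> b = w)" for b j'
  have "finite {j'. \<exists>b. P b j'}"
    by (rule finite_subset[OF _ finite_finite_levels[OF order_refl]])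
       (auto simp: P_def finite_levels_def)
  moreover have "P w j"
    using w by (simp add: P_def)
  ultimately have Max: "Max {j'. \<exists>b. P b j'} \<in> {j'. \<exists>b. P b j'}"
    by (intro Max_in) auto
  define m where "m = Max {j'. \<exists>b. P b j'}"
  obtain b where b: "P b m"
    using Max by (auto simp: m_def)
  have m: "m' \<le> m" if "P b' m'" for b' m'
    unfolding m_def using that \<open>finite {j'. \<exists>b. P b j'}\<close> by (intro Max_ge) auto
  have nonroot: "b \<in> nodes T - {root_node T}"
    using b level_eq_Fin_imp_nonroot by (auto simp: P_def)
  have "dist p (parent T b) \<le> dist p b + dist b (parent T b)"
    by (rule dist_triangle)
  also have "\<dots> \<le> 2 powi (m + 1) + 2 powi (m + 1)"
    using b dist_parent_le[OF nonroot] by (intro add_mono) (auto simp: P_def)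
  also have "\<dots> = 2 powi (m + 1 + 1)"
    using two_powi_plus_one[of "m + 1"] by linarith
  finally have dist: "dist p (parent T b) \<le> 2 powi m'" if "m + 1 + 1 \<le> m'" for m'
    using that by (meson order_trans two_powi_le_iff)
  have less: "Fin m < level T (parent T b)"
    using level_less_parent[OF nonroot] b by (simp add: P_def)
  \<comment> \<open>Otherwise the parent has a finite level above \<open>m\<close> and again
    satisfies \<open>P\<close>, contradicting the maximality of \<open>m\<close>.\<close>
  have "k \<le> level T (parent T b)"
  proof (rule ccontr)
    assume "\<not> ?thesis"
    then have "level T (parent T b) < k"
      by simp
    with less obtain m' where m': "level T (parent T b) = Fin m'" "m < m'"
      by (cases "level T (parent T b)") auto
    then have "P (parent T b) m'"
      using b dist[of "m' + 1"] \<open>level T (parent T b) < k\<close> nonroot parent_in_nodes by (auto simp: P_def)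
    with m m'(2) show False
      by fastforce
  qed
  moreover have "Fin m < k"
    using b by (simp add: P_def)
  ultimately have "parent T b \<in> candidates p k"
  proof (cases k)
    case (Fin i)
    with \<open>k \<le> _\<close> \<open>Fin m < k\<close> show ?thesis
      using dist[of "i + 1"] nonroot parent_in_nodes by auto
  next
    case Pinf
    then have "level T (parent T b) = Pinf"
      using \<open>k \<le> _\<close> by simp
    then show ?thesis
      using level_nonroot[of "parent T b"] nonroot parent_in_nodes Pinf by force
  qed simp
  then show ?thesis
    using that[of b m] b nonroot by (auto simp: P_def children_def)
qed

text \<open>One round of the loop is correct: \<open>gap\<close> says that no child of a candidate
  at \<open>k\<close> has a level strictly between \<open>i\<close> and \<open>k\<close>. A node
  sought at or above \<open>k\<close> is already a candidate there, as the radius only grows. For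
  one below \<open>k\<close>, the node from \<open>obtain_ancestor\<close> has level at most
  \<open>i\<close> by \<open>gap\<close>, so no climbing took place and the node is a child at level
  \<open>i\<close>.\<close>

lemma candidates_step:
  assumes "Fin i < k"
    and gap: "\<And>b j. parent T b \<in> candidates p k \<Longrightarrow> b \<in> children T (parent T b) \<Longrightarrow>
      level T b = Fin j \<Longrightarrow> Fin j < k \<Longrightarrow> j \<le> i"
  shows "{a \<in> candidates p k \<union> {a. \<exists>q\<in>candidates p k. a \<in> children T q \<and> level T a = Fin i}.
           dist p a \<le> 2 powi (i + 1)} = candidates p (Fin i)" (is "?L = _")
proof (intro equalityI subsetI)
  fix a assume a: "a \<in> ?L"
  have "Fin i \<le> level T a" if "a \<in> candidates p k"
    using candidates_level[OF that] assms(1) by auto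
  with a show "a \<in> candidates p (Fin i)"
    using candidates_subset[of p k] by (auto simp: children_def)
next
  fix a assume a: "a \<in> candidates p (Fin i)"
  show "a \<in> ?L"
  proof (cases "k \<le> level T a")
    case True
    have "a \<in> candidates p k"
    proof (cases k)
      case (Fin i')
      have "dist p a \<le> 2 powi (i + 1)"
        using a by simp
      also have "\<dots> \<le> 2 powi (i' + 1)"
        using assms(1) Fin by simp
      finally show ?thesis
        using a True Fin by simp
    next
      case Pinf
      then show ?thesis
        using True a level_nonroot[of a] by force
    qed (use assms(1) in auto)
    then show ?thesis
      using a by simp
  next
    case False
    then have "level T a < k"
      by simp
    then obtain j where j: "level T a = Fin j" "i \<le> j" "Fin j < k"
      using a by (cases "level T a") auto
    moreover have "dist p a \<le> 2 powi (j + 1)"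
    proof -
      have "dist p a \<le> 2 powi (i + 1)"
        using a by simp
      also have "\<dots> \<le> 2 powi (j + 1)"
        using j(2) by simp
      finally show ?thesis .
    qed
    ultimately obtain b j' where b: "b \<in> children T (parent T b)" "parent T b \<in> candidates p k"
      "level T b = Fin j'" "Fin j' < k" "j \<le> j'" "j' = j \<Longrightarrow> b = a"
      using obtain_ancestor[of a j p k] a by auto
    have "j' \<le> i"
      using gap b by blast
    then have "b = a" "j = i"
      using b j by auto
    then show ?thesis
      using a b j by auto
  qed
qed


section \<open>The descent\<close>

text \<open>The last clause demands a key only for nodes that are candidates at their own level. It
  therefore survives an early exit on an empty set.\<close>

definition complete_dictionary :: "'a \<Rightarrow> 'a dictionary \<Rightarrow> bool" where
  "complete_dictionary p M \<longleftrightarrow>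
     Pinf \<in> dom M \<and>
     (\<forall>k\<in>dom M. M k = Some (candidates p k)) \<and>
     (\<forall>w\<in>nodes T. \<forall>j. level T w = Fin j \<longrightarrow> dist p w \<le> 2 powi (j + 1) \<longrightarrow> Fin j \<in> dom M)"

text \<open>
  One round costs at most \<open>11 * K\<^sup>2\<close> if \<open>K\<close> bounds the candidate sets and the groups of children,
  since then \<open>\<C>\<^sub>i\<close> has at most \<open>K\<^sup>2\<close> elements.
\<close>

lemma descend_complete:
  fixes K :: nat
  assumes K: "\<And>k. card (candidates p k) \<le> K"
    "\<And>q i. q \<in> nodes T \<Longrightarrow> Fin i < level T q \<Longrightarrow>
       card (insert q {a \<in> children T q. level T a = Fin i}) \<le> K"
    and "min_level T - 1 \<le> i" "i \<le> max_nonroot_level T" "Fin i < ip"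
    and "Pinf \<in> dom M" "dom M \<subseteq> insert Pinf (Fin ` {min_level T..max_nonroot_level T})"
    and "\<And>k. k \<in> dom M \<Longrightarrow> M k = Some (candidates p k)"
    and "ip \<in> dom M"
    and "\<And>w j. w \<in> nodes T \<Longrightarrow> level T w = Fin j \<Longrightarrow> dist p w \<le> 2 powi (j + 1) \<Longrightarrow>
           ip \<le> Fin j \<Longrightarrow> Fin j \<in> dom M"
    and "\<And>b j. parent T b \<in> candidates p ip \<Longrightarrow> b \<in> children T (parent T b) \<Longrightarrow>
      level T b = Fin j \<Longrightarrow> Fin j < ip \<Longrightarrow> j \<le> i"
  shows "\<exists>M' n'. descend T p i ip M n = Some (M', n') \<and> complete_dictionary p M' \<and>
    dom M' \<subseteq> insert Pinf (Fin ` {min_level T..max_nonroot_level T}) \<and>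
    n' \<le> n + 1 + 11 * K\<^sup>2 * nat (i - min_level T + 1)"
  using assms(3-)
proof (induction "nat (i - min_level T + 1)" arbitrary: i ip M n rule: less_induct)
  case less
  note gap = less.prems(9)
  show ?case
  proof (cases "i < min_level T")
    case True
    \<comment> \<open>A missing level \<open>j\<close> would satisfy \<open>j\<close> \<le>
      \<open>i\<close>, below the minimum level.\<close>
    have "Fin j \<in> dom M"
      if w: "w \<in> nodes T" "level T w = Fin j" "dist p w \<le> 2 powi (j + 1)" for w j
    proof (cases "ip \<le> Fin j")
      case False
      then have "Fin j < ip" by simp
      with w obtain b j' where b: "b \<in> children T (parent T b)" "parent T b \<in> candidates p ip"
        "level T b = Fin j'" "Fin j' < ip" "j \<le> j'"
        by (elim obtain_ancestor)
      then have "j' \<le> i"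
        using gap by blast
      then show ?thesis
        using True b(5) min_level_le[OF w(1,2)] by simp
    qed (use w less.prems(8) in blast)
    then have "complete_dictionary p M"
      using less.prems(4-6) by (auto simp: complete_dictionary_def)
    then show ?thesis
      using True less.prems(5) by (subst descend.simps) auto
  next
    case False
    define Ci where "Ci = candidates p ip \<union>
      {a. \<exists>q\<in>candidates p ip. a \<in> children T q \<and> level T a = Fin i}"
    define M1 where "M1 = M(Fin i \<mapsto> candidates p (Fin i))"
    define n1 where "n1 = n + 1 + card (candidates p ip) + 3 * card Ci + 2"
    define t where "t = Max ((\<lambda>a. next_level T a i) ` candidates p (Fin i))"
    have Mip: "the (M ip) = candidates p ip"
      using less.prems(6)[OF less.prems(7)] by simp
    have step: "{a \<in> Ci. dist p a \<le> 2 powi (i + 1)} = candidates p (Fin i)"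
      unfolding Ci_def using less.prems(3) gap by (rule candidates_step)
    have eq: "descend T p i ip M n = (if candidates p (Fin i) = {} then Some (M1, n1)
        else descend T p t (Fin i) M1 (n1 + 2 * card (candidates p (Fin i)) + 2))"
      using False
      by (subst descend.simps)
         (simp only: Let_def Mip Ci_def[symmetric] step M1_def n1_def t_def if_False)
    have dom1: "Pinf \<in> dom M1" "dom M1 \<subseteq> insert Pinf (Fin ` {min_level T..max_nonroot_level T})"
      "\<And>k. k \<in> dom M1 \<Longrightarrow> M1 k = Some (candidates p k)" "Fin i \<in> dom M1"
      using less.prems(2,4,5,6) False by (auto simp: M1_def simp del: candidates.simps)
    \<comment> \<open>Below \<open>ip\<close>, climbing from \<open>w\<close> ends at a level at
      most \<open>i\<close>; hence \<open>j = i\<close>, the key just stored.\<close>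
    have compl1: "Fin j \<in> dom M1"
      if w: "w \<in> nodes T" "level T w = Fin j" "dist p w \<le> 2 powi (j + 1)" "Fin i \<le> Fin j" for w j
    proof (cases "ip \<le> Fin j")
      case False
      then have "Fin j < ip" by simp
      with w(1-3) obtain b j' where b: "b \<in> children T (parent T b)" "parent T b \<in> candidates p ip"
        "level T b = Fin j'" "Fin j' < ip" "j \<le> j'"
        by (elim obtain_ancestor)
      then have "j' \<le> i"
        using gap by blast
      then show ?thesis
        using b(5) w(4) by (auto simp: M1_def)
    next
      case True
      then show ?thesis
        using w less.prems(8) by (auto simp: M1_def)
    qed
    have cardC: "card Ci \<le> K\<^sup>2"
    proof -
      have less_level: "Fin i < level T q" if "q \<in> candidates p ip" for q
        using candidates_level[OF that] less.prems(3) by auto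
      have "Ci = (\<Union>q\<in>candidates p ip. insert q {a \<in> children T q. level T a = Fin i})"
        by (auto simp: Ci_def)
      then have "card Ci \<le> (\<Sum>q\<in>candidates p ip. card (insert q {a \<in> children T q. level T a = Fin i}))"
        by (simp only: card_UN_le[OF finite_candidates])
      also have "\<dots> \<le> (\<Sum>q\<in>candidates p ip. K)"
        using K(2) less_level candidates_subset by (intro sum_mono) blast
      also have "\<dots> \<le> K\<^sup>2"
        using K(1)[of ip] by (simp add: power2_eq_square)
      finally show ?thesis .
    qed
    have "1 \<le> K"
      using K(1)[of Pinf] by simp
    then have K1: "K \<le> K\<^sup>2" "1 \<le> K\<^sup>2"
      by (simp_all add: power2_eq_square)
    \<comment> \<open>The charge 3K + 3K^2 + 5 of a round is at most 11K^2, as K is at least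
      1.\<close>
    have n1: "n1 + 2 * card (candidates p (Fin i)) + 2 \<le> n + 11 * K\<^sup>2"
      using cardC K(1)[of ip] K(1)[of "Fin i"] K1 unfolding n1_def by linarith
    show ?thesis
    proof (cases "candidates p (Fin i) = {}")
      case True
      \<comment> \<open>A relevant node below level \<open>i\<close> would yield a candidate at
        \<open>i\<close>, but there is none.\<close>
      have "Fin j \<in> dom M1"
        if w: "w \<in> nodes T" "level T w = Fin j" "dist p w \<le> 2 powi (j + 1)" for w j
      proof (rule ccontr)
        assume "Fin j \<notin> dom M1"
        then have "Fin j < Fin i"
          using compl1[OF w] by (auto simp: not_le[symmetric])
        with w obtain b where "parent T b \<in> candidates p (Fin i)"
          by (elim obtain_ancestor)
        then show False
          using True by (simp del: candidates.simps)
      qed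
      then have "complete_dictionary p M1"
        using dom1 by (auto simp: complete_dictionary_def)
      moreover have "1 \<le> nat (i - min_level T + 1)"
        using False by linarith
      then have "11 * K\<^sup>2 \<le> 11 * K\<^sup>2 * nat (i - min_level T + 1)"
        by (simp only: mult_le_mono2[of 1, simplified mult.right_neutral])
      ultimately show ?thesis
        using eq[unfolded if_P[OF True]] n1 dom1(2)
        by (intro exI[of _ M1] exI[of _ n1] conjI) linarith+
    next
      case nonempty: False
      have t_in: "t \<in> (\<lambda>a. next_level T a i) ` candidates p (Fin i)"
        unfolding t_def using nonempty by (intro Max_in finite_imageI finite_candidates) blast
      then have t: "min_level T - 1 \<le> t" "t < i"
        using next_level_bounds[of i] False by auto
      \<comment> \<open>Since \<open>t\<close> is the maximum of the next levels, the gap condition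
        passes to the next round.\<close>
      have gap': "j \<le> t" if b: "parent T b \<in> candidates p (Fin i)" "b \<in> children T (parent T b)"
        "level T b = Fin j" "Fin j < Fin i" for b j
      proof -
        have "j \<le> next_level T (parent T b) i"
          using b le_next_level by auto
        also have "\<dots> \<le> t"
          unfolding t_def using b(1) by (intro Max_ge finite_imageI finite_candidates imageI)
        finally show ?thesis .
      qed
      have "nat (t - min_level T + 1) < nat (i - min_level T + 1)"
        using t False by linarith
      then have "\<exists>M' n'. descend T p t (Fin i) M1 (n1 + 2 * card (candidates p (Fin i)) + 2) = Some (M', n') \<and>
        complete_dictionary p M' \<and>
        dom M' \<subseteq> insert Pinf (Fin ` {min_level T..max_nonroot_level T}) \<and>
        n' \<le> n1 + 2 * card (candidates p (Fin i)) + 2 + 1 + 11 * K\<^sup>2 * nat (t - min_level T + 1)"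
        by (rule less.hyps) (use t less.prems(2) dom1 compl1 gap' in auto)
      then obtain M' n' where M': "descend T p i ip M n = Some (M', n')" "complete_dictionary p M'"
        "dom M' \<subseteq> insert Pinf (Fin ` {min_level T..max_nonroot_level T})"
        "n' \<le> n1 + 2 * card (candidates p (Fin i)) + 2 + 1 + 11 * K\<^sup>2 * nat (t - min_level T + 1)"
        unfolding eq[unfolded if_not_P[OF nonempty]] by blast
      have "nat (t - min_level T + 1) + 1 \<le> nat (i - min_level T + 1)"
        using t False by linarith
      then have "11 * K\<^sup>2 * (nat (t - min_level T + 1) + 1) \<le> 11 * K\<^sup>2 * nat (i - min_level T + 1)"
        by (rule mult_le_mono2)
      then have "n' \<le> n + 1 + 11 * K\<^sup>2 * nat (i - min_level T + 1)"
        using M'(4) n1 by (simp add: algebra_simps)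
      with M' show ?thesis
        by auto
    qed
  qed
qed


section \<open>Attaching a point\<close>

text \<open>Nearness at \<open>k\<close> gives \<open>Fin x < k\<close>, and \<open>q\<close> has
  level at least \<open>k\<close>; this places \<open>p\<close> below its parent. The only new
  separations are those between \<open>p\<close> and old nodes, and they rest on the minimality of
  \<open>k\<close>.\<close>

lemma partial_cover_tree_attach:
  assumes p: "p \<notin> nodes T" and M: "complete_dictionary p M"
    and k: "k \<in> dom M" "near p k (candidates p k)"
      "\<And>k'. k' \<in> dom M \<Longrightarrow> near p k' (candidates p k') \<Longrightarrow> k \<le> k'"
    and q: "q \<in> candidates p k" "dist p q = infdist p (candidates p k)"
  defines "x \<equiv> (GREATEST x. dist p q > 2 powi x)"
  shows "partial_cover_tree (attach T p q x)"
proof -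
  have qT: "q \<in> nodes T"
    using q(1) candidates_subset by auto
  have "0 < dist p q"
    using p qT by auto
  note x = Greatest_two_powi_less[OF this, folded x_def]
  have x_less_k: "Fin x < k"
  proof (cases k)
    case (Fin i)
    then have "dist p q \<le> 2 powi i"
      using k(2) q(2) by simp
    with x(1) have "(2::real) powi x < 2 powi i"
      by (rule less_le_trans)
    then show ?thesis
      by (simp add: Fin)
  qed (use k in auto)
  have x_less: "Fin x < level T q"
    using x_less_k candidates_level[OF q(1)] by simp
  have sep: "2 powi i < dist p w" if w: "w \<in> nodes T" "Fin i \<le> level T w" "i \<le> x" for w i
  proof (rule ccontr)
    assume "\<not> ?thesis"
    then have le_i: "dist p w \<le> 2 powi i"
      by simp
    have le: "dist p w \<le> 2 powi j" if "i \<le> j" for j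
      using le_i that by (meson order_trans two_powi_le_iff)
    \<comment> \<open>At a finite level, \<open>w\<close> makes its own key pass the test, and the
      first passing key is \<open>k\<close>.\<close>
    have "k \<le> level T w"
    proof (cases "level T w")
      case (Fin j)
      then have "i \<le> j"
        using w(2) by simp
      have cand: "w \<in> candidates p (Fin j)"
        using w(1) Fin le[of "j + 1"] \<open>i \<le> j\<close> by simp
      have "infdist p (candidates p (Fin j)) \<le> 2 powi j"
        using infdist_le[OF cand, of p] le[OF \<open>i \<le> j\<close>] by linarith
      then have "near p (Fin j) (candidates p (Fin j))"
        using cand by (auto simp del: candidates.simps)
      moreover have "Fin j \<in> dom M"
        using M w(1) Fin le[of "j + 1"] \<open>i \<le> j\<close> by (simp add: complete_dictionary_def)
      ultimately show ?thesis
        using k(3) Fin by simp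
    qed (use w in auto)
    have "w \<in> candidates p k"
    proof (cases k)
      case (Fin j)
      then have "i \<le> j + 1"
        using x_less_k w(3) by simp
      then show ?thesis
        using w(1) le \<open>k \<le> level T w\<close> Fin by simp
    next
      case Pinf
      then show ?thesis
        using \<open>k \<le> level T w\<close> level_nonroot[of w] w(1) by force
    qed (use x_less_k in simp)
    then have "dist p q \<le> dist p w"
      using q(2) infdist_le by simp
    then show False
      using le[OF w(3)] x(1) by simp
  qed
  let ?T = "attach T p q x"
  have sel: "nodes ?T = insert p (nodes T)" "root_node ?T = root_node T"
    "parent ?T = (parent T)(p := q)" "level ?T = (level T)(p := Fin x)"
    by (simp_all add: attach_def)
  have neq: "a \<noteq> p" if "a \<in> nodes T" for a
    using p that by auto
  \<comment> \<open>Iterates from old nodes never meet \<open>p\<close>, so the update of the parent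
    map leaves them unchanged.\<close>
  have iter: "((parent ?T) ^^ n) a = (parent T ^^ n) a \<and> (parent T ^^ n) a \<in> nodes T"
    if "a \<in> nodes T" for a n
    by (induction n) (auto simp: that sel neq parent_in_nodes)
  show ?thesis
  proof
    show "finite (nodes ?T)"
      using finite_nodes by (simp add: sel)
    show "root_node ?T \<in> nodes ?T"
      using root_in_nodes by (simp add: sel)
    show "parent ?T (root_node ?T) = root_node ?T"
      using neq[OF root_in_nodes] parent_root by (simp add: sel)
    show "level ?T (root_node ?T) = Pinf"
      using neq[OF root_in_nodes] level_root by (simp add: sel)
    show "parent ?T a \<in> nodes ?T" if "a \<in> nodes ?T" for a
      using that qT parent_in_nodes by (auto simp: sel)
    show "\<exists>n. (parent ?T ^^ n) a = root_node ?T" if "a \<in> nodes ?T" for a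
    proof (cases "a = p")
      case True
      obtain n where "(parent T ^^ n) q = root_node T"
        using reaches_root qT by blast
      then have "(parent ?T ^^ Suc n) p = root_node ?T"
        using iter[OF qT, of n] by (simp only: funpow_Suc_right o_apply) (simp add: sel)
      then show ?thesis
        using True by blast
    next
      case False
      then have "a \<in> nodes T"
        using that by (simp add: sel)
      then show ?thesis
        using reaches_root[of a] iter[of a] by (auto simp: sel(2))
    qed
    show "\<exists>j. level ?T a = Fin j" if "a \<in> nodes ?T - {root_node ?T}" for a
      using that level_nonroot by (auto simp: sel)
    show "level ?T a < level ?T (parent ?T a)" if "a \<in> nodes ?T - {root_node ?T}" for a
      using that level_less_parent neq qT x_less parent_in_nodes by (auto simp: sel)
    show "dist a (parent ?T a) \<le> 2 powi (j + 1)"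
      if "a \<in> nodes ?T - {root_node ?T}" "level ?T a = Fin j" for a j
      using that dist_parent_le x(2) by (auto simp: sel split: if_splits)
    show "2 powi i < dist a b"
      if "a \<in> nodes ?T" "b \<in> nodes ?T" "a \<noteq> b" "Fin i \<le> level ?T a" "Fin i \<le> level ?T b" for a b i
      using that sep separated by (auto simp: sel dist_commute split: if_splits)
  qed
qed

text \<open>The bounds \<open>K\<close>, \<open>lo\<close> and \<open>hi\<close> are given from
  outside, so that one cost bound serves all insertions.\<close>

lemma add_point_correct:
  fixes K :: nat
  assumes p: "p \<notin> nodes T"
    and ch: "\<And>S. S \<noteq> {} \<Longrightarrow> ch p S \<in> S"
    and K: "\<And>k. card (candidates p k) \<le> K"
      "\<And>q i. q \<in> nodes T \<Longrightarrow> Fin i < level T q \<Longrightarrow>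
         card (insert q {a \<in> children T q. level T a = Fin i}) \<le> K"
    and lohi: "\<And>a j. a \<in> nodes T \<Longrightarrow> level T a = Fin j \<Longrightarrow> lo \<le> j \<and> j \<le> hi"
  defines "H \<equiv> nat (hi - lo + 1)"
  shows "\<exists>q x n. add_point ch T p = Some (attach T p q x, n) \<and> q \<in> nodes T \<and>
    partial_cover_tree (attach T p q x) \<and> n \<le> 17 * K\<^sup>2 * (H + 1)"
proof -
  define M0 :: "'a dictionary" where "M0 = [Pinf \<mapsto> {root_node T}]"
  define I where "I = insert Pinf (Fin ` {lo..hi})"
  have "card I = Suc (card ((Fin :: int \<Rightarrow> int extended) ` {lo..hi}))"
    unfolding I_def by (subst card_insert_disjoint) auto
  also have "card ((Fin :: int \<Rightarrow> int extended) ` {lo..hi}) = H"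
    by (subst card_image) (auto simp: H_def inj_on_def)
  finally have I: "finite I" "card I = H + 1"
    by (simp_all add: I_def)
  obtain M n0 where M: "(if nodes T = {root_node T} then Some (M0, 2)
      else descend T p (max_nonroot_level T) Pinf M0 5) = Some (M, n0)"
    "complete_dictionary p M" "dom M \<subseteq> I" "n0 \<le> 6 + 11 * K\<^sup>2 * H"
  proof (cases "nodes T = {root_node T}")
    case True
    have "complete_dictionary p M0"
      using True level_root by (auto simp: complete_dictionary_def M0_def)
    then show ?thesis
      using that[of M0 2] True by (auto simp: M0_def I_def)
  next
    case False
    note ext = extremal_level_attained[OF False]
    have le: "lo \<le> min_level T" "max_nonroot_level T \<le> hi" "min_level T \<le> max_nonroot_level T"
      using ext lohi min_level_le by blast+
    have "\<exists>M n. descend T p (max_nonroot_level T) Pinf M0 5 = Some (M, n) \<and>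
      complete_dictionary p M \<and> dom M \<subseteq> insert Pinf (Fin ` {min_level T..max_nonroot_level T}) \<and>
      n \<le> 5 + 1 + 11 * K\<^sup>2 * nat (max_nonroot_level T - min_level T + 1)"
    proof (rule descend_complete[OF K])
      \<comment> \<open>The gap condition holds at the start because the descent begins at the
        highest finite level.\<close>
      show "j \<le> max_nonroot_level T"
        if "b \<in> children T (parent T b)" "level T b = Fin j" for b j
        using that children_subset le_max_nonroot_level by blast
    qed (use le in \<open>auto simp: M0_def\<close>)
    then obtain M n where M: "descend T p (max_nonroot_level T) Pinf M0 5 = Some (M, n)"
      "complete_dictionary p M" "dom M \<subseteq> insert Pinf (Fin ` {min_level T..max_nonroot_level T})"
      "n \<le> 5 + 1 + 11 * K\<^sup>2 * nat (max_nonroot_level T - min_level T + 1)"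
      by blast
    have "nat (max_nonroot_level T - min_level T + 1) \<le> H"
      unfolding H_def using le by linarith
    then have "11 * K\<^sup>2 * nat (max_nonroot_level T - min_level T + 1) \<le> 11 * K\<^sup>2 * H"
      by (rule mult_le_mono2)
    then have "n \<le> 6 + 11 * K\<^sup>2 * H"
      using M(4) by linarith
    moreover have "dom M \<subseteq> I"
      using M(3) le unfolding I_def by force
    ultimately show ?thesis
      using that[of M n] M(1,2) False by simp
  qed
  have the_M: "the (M j) = candidates p j" if "j \<in> dom M" for j
    using M(2) that by (auto simp: complete_dictionary_def)
  have finM: "finite (dom M)"
    using M(3) I(1) by (rule finite_subset)
  define k where "k = Min {k \<in> dom M. near p k (the (M k))}"
  \<comment> \<open>The key \<open>Pinf\<close> always passes the test, so the minimum is over a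
    nonempty set.\<close>
  have "Pinf \<in> {k \<in> dom M. near p k (the (M k))}"
    using M(2) by (simp add: complete_dictionary_def)
  then have "k \<in> {k \<in> dom M. near p k (the (M k))}"
    unfolding k_def using finM by (intro Min_in) auto
  then have "k \<in> dom M \<and> near p k (the (M k))"
    by (rule CollectD)
  then have k: "k \<in> dom M" "near p k (candidates p k)"
    using the_M[of k] by (simp_all only:)
  have k_le: "k \<le> k'" if "k' \<in> dom M" "near p k' (candidates p k')" for k'
    unfolding k_def using that the_M finM by (intro Min_le) auto
  have ne: "candidates p k \<noteq> {}"
    using k(2) by (cases k) (auto simp del: candidates.simps(1))
  define q where "q = ch p {q \<in> candidates p k. dist p q = infdist p (candidates p k)}"
  have "{q \<in> candidates p k. dist p q = infdist p (candidates p k)} \<noteq> {}"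
    using infdist_attained_finite[OF finite_candidates ne, of p] by auto
  then have "q \<in> {q \<in> candidates p k. dist p q = infdist p (candidates p k)}"
    unfolding q_def by (rule ch)
  then have q: "q \<in> candidates p k" "dist p q = infdist p (candidates p k)"
    by auto
  define x where "x = (GREATEST x. dist p q > 2 powi x)"
  define n where "n = n0 + (\<Sum>j \<in> {j \<in> dom M. j \<le> k}. 2 + 2 * card (the (M j)))
    + 2 * card (candidates p k) + 1 + card (finite_levels T (children T q)) + 4"
  have "add_point ch T p = Some (attach T p q x, n)"
    unfolding add_point_def Let_def M0_def[symmetric] M(1)
    using the_M[OF k(1)] by (simp add: k_def[symmetric] q_def[symmetric] x_def n_def)
  moreover have "partial_cover_tree (attach T p q x)"
    unfolding x_def using p M(2) k k_le q by (rule partial_cover_tree_attach)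
  moreover have "n \<le> 17 * K\<^sup>2 * (H + 1)"
  proof -
    have "(\<Sum>j \<in> {j \<in> dom M. j \<le> k}. 2 + 2 * card (the (M j))) \<le> (\<Sum>j \<in> {j \<in> dom M. j \<le> k}. 2 + 2 * K)"
      using K(1) the_M by (intro sum_mono) auto
    also have "\<dots> = card {j \<in> dom M. j \<le> k} * (2 + 2 * K)"
      by simp
    also have "\<dots> \<le> (H + 1) * (2 + 2 * K)"
    proof (rule mult_le_mono1)
      show "card {j \<in> dom M. j \<le> k} \<le> H + 1"
        unfolding I(2)[symmetric] using M(3) I(1) by (intro card_mono) auto
    qed
    finally have sum: "(\<Sum>j \<in> {j \<in> dom M. j \<le> k}. 2 + 2 * card (the (M j))) \<le> (H + 1) * (2 + 2 * K)" .
    have "card (finite_levels T (children T q)) \<le> card {lo..hi}"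
      using lohi children_subset[of q] by (intro card_mono) (auto simp: finite_levels_def)
    then have fl: "card (finite_levels T (children T q)) \<le> H"
      by (simp add: H_def)
    have "1 \<le> K"
      using K(1)[of Pinf] by simp
    then have K1: "K \<le> K\<^sup>2" "1 \<le> K\<^sup>2"
      by (simp_all add: power2_eq_square)
    have "(H + 1) * (2 + 2 * K) \<le> (H + 1) * (4 * K\<^sup>2)"
      using K1 by (intro mult_le_mono2) linarith
    moreover have "H \<le> K\<^sup>2 * H"
      using K1 by simp
    \<comment> \<open>In order: the descent, the scan of the keys, the choice of \<open>q\<close>,
      the computation of \<open>x\<close>, the walk through the child levels, the recording. The
      constant 17 is 4 + 2 + 11 from the terms without \<open>H\<close>.\<close>
    ultimately have "n \<le> (6 + 11 * K\<^sup>2 * H) + (H + 1) * (4 * K\<^sup>2) + 2 * K + 1 + K\<^sup>2 * H + 4"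
      unfolding n_def using M(4) sum K(1)[of k] fl by linarith
    also have "\<dots> = 16 * (K\<^sup>2 * H) + 4 * K\<^sup>2 + 2 * K + 11"
      by (simp add: algebra_simps)
    also have "\<dots> \<le> 17 * (K\<^sup>2 * H) + 17 * K\<^sup>2"
      using K1 by linarith
    finally show ?thesis
      by (simp add: algebra_simps)
  qed
  moreover have "q \<in> nodes T"
    using q(1) candidates_subset by blast
  ultimately show ?thesis
    by blast
qed

text \<open>Lowering the root from \<open>Pinf\<close> only shrinks cover sets, so separation
  survives, and the new level still exceeds all others. For a one-point tree every condition on the
  unspecified level is vacuous or trivial.\<close>

lemma compressed_cover_tree_set_root_level:
  "compressed_cover_tree (nodes T) (set_root_level T)"
proof -
  let ?S = "set_root_level T"
  have sel: "nodes ?S = nodes T" "root_node ?S = root_node T" "parent ?S = parent T"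
    "level ?S (root_node T) = 1 + max_nonroot_level T"
    by (simp_all add: set_root_level_def)
  have level: "level T q = Fin (level ?S q)" if "q \<in> nodes T - {root_node T}" for q
    using level_nonroot[OF that] that by (auto simp: set_root_level_def)
  have level_le: "level ?S q \<le> max_nonroot_level T" if "q \<in> nodes T - {root_node T}" for q
    using level[OF that] that le_max_nonroot_level by blast
  have Fin_le: "Fin i \<le> level T q" if "q \<in> nodes T" "i \<le> level ?S q" for q i
    using that level[of q] level_root by (cases "q = root_node T") auto
  have "level ?S q < level ?S (parent T q)" if "q \<in> nodes T - {root_node T}" for q
    using that level_less_parent[OF that] level[OF that] level[of "parent T q"] level_le[OF that]
      parent_in_nodes[of q] sel(4) by (cases "parent T q = root_node T") auto
  then show ?thesis
    using finite_nodes root_in_nodes parent_in_nodes reaches_root level_le dist_parent_le level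
      separated Fin_le
    by (auto simp: compressed_cover_tree_def rooted_tree_def cover_set_def sel)
qed

section \<open>Sizes of candidate sets and child groups, range of levels\<close>

lemma card_candidates_le:
  assumes "nodes T \<subseteq> R" "minimized_expansion_constant R = ereal c" "1 \<le> c"
  shows "real (card (candidates p k)) \<le> c ^ 4"
proof (cases k)
  case (Fin i)
  show ?thesis
    using assms candidates_subset[of p k] finite_candidates[of p k] separated Fin
    by (intro card_separated_le[of R c _ p i]) auto
qed (use assms in auto)

text \<open>The packing bound in the ball around \<open>q\<close>. Counting \<open>q\<close> with
  its children matches the union over candidates that makes up \<open>Ci\<close> in a round.\<close>

lemma card_child_group_le:
  assumes "nodes T \<subseteq> R" "minimized_expansion_constant R = ereal c" "q \<in> nodes T" "Fin i < level T q"
  shows "real (card (insert q {a \<in> children T q. level T a = Fin i})) \<le> c ^ 4"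
proof (rule card_separated_le[OF assms(2)])
  let ?S = "insert q {a \<in> children T q. level T a = Fin i}"
  have S: "?S \<subseteq> nodes T"
    using assms(3) children_subset by auto
  then show "finite ?S" "?S \<subseteq> R"
    using finite_nodes assms(1) by (auto intro: finite_subset)
  show "?S \<subseteq> cball q (2 powi (i + 1))"
    using dist_parent_le by (auto simp: children_def dist_commute)
  have "Fin i \<le> level T x" if "x \<in> ?S" for x
    using that assms(4) by auto
  then show "2 powi i < dist x y" if "x \<in> ?S" "y \<in> ?S" "x \<noteq> y" for x y
    using that S separated by blast
qed

lemma level_bounds:
  assumes "finite R" "nodes T \<subseteq> R" "a \<in> nodes T" "level T a = Fin j"
  shows "\<lceil>log 2 (d_min R)\<rceil> - 1 \<le> j \<and> j \<le> \<lceil>log 2 (diameter R)\<rceil> - 1"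
proof
  have a: "a \<in> nodes T - {root_node T}"
    using level_eq_Fin_imp_nonroot assms(3,4) .
  have "a \<noteq> parent T a"
    using level_less_parent[OF a] by auto
  then have "0 < d_min R" "d_min R \<le> dist a (parent T a)"
    using d_min_pos_le[of R a "parent T a"] assms(1-3) parent_in_nodes by auto
  then have "0 < d_min R" "d_min R \<le> 2 powr (real_of_int (j + 1))"
    using dist_parent_le[OF a assms(4)] unfolding two_powi_eq_powr by auto
  then have "log 2 (d_min R) \<le> real_of_int (j + 1)"
    by (simp add: log_le_iff)
  then show "\<lceil>log 2 (d_min R)\<rceil> - 1 \<le> j"
    by linarith
  \<comment> \<open>The root, at level \<open>Pinf\<close>, is separated from \<open>a\<close> at
    the level of \<open>a\<close>.\<close>
  have "2 powi j < dist a (root_node T)"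
    using separated[of a "root_node T" j] a root_in_nodes assms(4) level_root by auto
  also have "\<dots> \<le> diameter R"
    using assms(1-3) root_in_nodes by (intro diameter_bounded_bound finite_imp_bounded) auto
  finally have "2 powr real_of_int j < diameter R"
    by (simp add: two_powi_eq_powr)
  then have "real_of_int j < log 2 (diameter R)"
    by (subst less_log_iff) (auto intro: le_less_trans[OF powr_ge_zero])
  then show "j \<le> \<lceil>log 2 (diameter R)\<rceil> - 1"
    by linarith
qed

end


section \<open>The construction\<close>

lemma partial_cover_tree_initial_tree: "partial_cover_tree (initial_tree r)"
  by unfold_locales (auto simp: initial_tree_def intro: exI[of _ 0])

text \<open>\<open>H\<close> and the packing bound depend on \<open>R\<close> alone, so each
  insertion has the same bound; the added 1 is the list step.\<close>

lemma add_points_correct: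
  fixes c :: real
  assumes R: "finite R" "minimized_expansion_constant R = ereal c" "1 \<le> c"
    and ch: "\<And>p S. S \<noteq> {} \<Longrightarrow> ch p S \<in> S"
    and T: "partial_cover_tree T" "nodes T \<subseteq> R" "distinct ps" "set ps \<subseteq> R - nodes T"
  defines "H \<equiv> nat (\<lceil>log 2 (diameter R)\<rceil> - \<lceil>log 2 (d_min R)\<rceil> + 1)"
  shows "\<exists>T' n. add_points ch T ps = Some (T', n) \<and> partial_cover_tree T' \<and>
    nodes T' = nodes T \<union> set ps \<and> root_node T' = root_node T \<and>
    n \<le> (17 * (nat \<lfloor>c ^ 4\<rfloor>)\<^sup>2 * (H + 1) + 1) * length ps"
  using T
proof (induction ps arbitrary: T)
  case Nil
  then show ?case
    by simp
next
  case (Cons p ps)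
  interpret partial_cover_tree T
    by fact
  have le_floor: "m \<le> nat \<lfloor>c ^ 4\<rfloor>" if "real m \<le> c ^ 4" for m
    using that by (simp add: le_nat_iff le_floor_iff)
  have "\<exists>q x n. add_point ch T p = Some (attach T p q x, n) \<and> q \<in> nodes T \<and>
    partial_cover_tree (attach T p q x) \<and>
    n \<le> 17 * (nat \<lfloor>c ^ 4\<rfloor>)\<^sup>2 * (nat ((\<lceil>log 2 (diameter R)\<rceil> - 1) - (\<lceil>log 2 (d_min R)\<rceil> - 1) + 1) + 1)"
  proof (rule add_point_correct)
    show "p \<notin> nodes T"
      using Cons.prems(4) by simp
    show "card (candidates p k) \<le> nat \<lfloor>c ^ 4\<rfloor>" for k
      by (rule le_floor card_candidates_le[OF Cons.prems(2) R(2,3)])+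
    show "card (insert q {a \<in> children T q. level T a = Fin i}) \<le> nat \<lfloor>c ^ 4\<rfloor>"
      if "q \<in> nodes T" "Fin i < level T q" for q i
      by (rule le_floor card_child_group_le[OF Cons.prems(2) R(2) that])+
    show "\<lceil>log 2 (d_min R)\<rceil> - 1 \<le> j \<and> j \<le> \<lceil>log 2 (diameter R)\<rceil> - 1"
      if "a \<in> nodes T" "level T a = Fin j" for a j
      by (rule level_bounds[OF R(1) Cons.prems(2) that])
  qed (rule ch)
  then obtain T1 n where T1: "add_point ch T p = Some (T1, n)" "partial_cover_tree T1"
    "nodes T1 = insert p (nodes T)" "root_node T1 = root_node T"
    "n \<le> 17 * (nat \<lfloor>c ^ 4\<rfloor>)\<^sup>2 * (H + 1)"
    unfolding H_def by (auto simp: attach_def)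
  have "nodes T1 \<subseteq> R" "distinct ps" "set ps \<subseteq> R - nodes T1"
    using Cons.prems T1(3) by auto
  from Cons.IH[OF T1(2) this] obtain T2 m where "add_points ch T1 ps = Some (T2, m)"
    "partial_cover_tree T2" "nodes T2 = nodes T1 \<union> set ps" "root_node T2 = root_node T1"
    "m \<le> (17 * (nat \<lfloor>c ^ 4\<rfloor>)\<^sup>2 * (H + 1) + 1) * length ps"
    by blast
  with T1 show ?case
    by (auto simp: algebra_simps)
qed

theorem theorem3p7:
  fixes R :: "'a::metric_space set" and r :: 'a and ps :: "'a list"
    and ch :: "'a \<Rightarrow> 'a set \<Rightarrow> 'a"
  assumes "finite R"
    and "r \<in> R"
    and "distinct ps" and "set ps = R - {r}"
    and "\<And>p S. S \<noteq> {} \<Longrightarrow> ch p S \<in> S"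
  shows "\<exists>T n. build_tree ch r ps = Some (T, n) \<and>
    compressed_cover_tree R T \<and> root_node T = r \<and>
    ereal (real n) \<le>
      1000 * minimized_expansion_constant R ^ 8
        * ereal (max 1 (log 2 (aspect_ratio R))) * ereal (real (card R))"
proof -
  obtain c where c: "minimized_expansion_constant R = ereal c" "1 \<le> c"
    using minimized_expansion_constant_ge_1[of R] minimized_expansion_constant_le_card[OF assms(1)] assms(2)
    by (cases "minimized_expansion_constant R") auto
  define L where "L = max 1 (log 2 (aspect_ratio R))"
  define H where "H = nat (\<lceil>log 2 (diameter R)\<rceil> - \<lceil>log 2 (d_min R)\<rceil> + 1)"
  define K where "K = nat \<lfloor>c ^ 4\<rfloor>"
  have "nodes (initial_tree r) = {r}" "root_node (initial_tree r) = r"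
    by (simp_all add: initial_tree_def)
  then obtain T n where T: "add_points ch (initial_tree r) ps = Some (T, n)" "partial_cover_tree T"
    "nodes T = R" "root_node T = r" "n \<le> (17 * K\<^sup>2 * (H + 1) + 1) * length ps"
    using add_points_correct[of R c ch "initial_tree r" ps,
        OF assms(1) c assms(5) partial_cover_tree_initial_tree] assms unfolding H_def K_def by (auto simp: insert_absorb)
  have card: "card R = length ps + 1"
    using assms by (metis Suc_eq_plus1 card.remove distinct_card)
  \<comment> \<open>With a second point, \<open>d_min R\<close> is meaningful and positive. Rounding
    gives \<open>H + 1\<close> at most L + 3, and L is at least 1.\<close>
  have H: "real (H + 1) \<le> 4 * L" if "ps \<noteq> []"
  proof -
    have p: "hd ps \<in> R" "hd ps \<noteq> r"
      using that assms(4) hd_in_set[OF that] by auto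
    then have "0 < d_min R"
      using d_min_pos_le[of R "hd ps" r] assms(1,2) by auto
    have "0 < dist (hd ps) r"
      using p by simp
    also have "\<dots> \<le> diameter R"
      using p assms(1,2) by (intro diameter_bounded_bound finite_imp_bounded) auto
    finally have "log 2 (aspect_ratio R) = log 2 (diameter R) - log 2 (d_min R)"
      unfolding aspect_ratio_def using \<open>0 < d_min R\<close> by (simp add: log_divide)
    then show ?thesis
      unfolding H_def L_def by linarith
  qed
  have K: "real (K\<^sup>2) \<le> c ^ 8"
  proof -
    have "real K \<le> c ^ 4"
      unfolding K_def using c(2) by simp
    then have "(real K)\<^sup>2 \<le> (c ^ 4)\<^sup>2"
      by (intro power_mono) auto
    then show ?thesis
      by simp
  qed
  have L: "1 \<le> L" "1 \<le> c ^ 8" "1 \<le> c ^ 8 * L"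
    using c(2) mult_mono[of 1 "c ^ 8" 1 L] by (auto simp: L_def)
  \<comment> \<open>The factor is 69 = 17 * 4 + 1.\<close>
  have "real ((17 * K\<^sup>2 * (H + 1) + 1) * length ps) \<le> (69 * (c ^ 8 * L)) * length ps"
  proof (cases "ps = []")
    case False
    have "real (K\<^sup>2) * real (H + 1) \<le> c ^ 8 * (4 * L)"
      using K H[OF False] L by (intro mult_mono) auto
    then have "real (17 * K\<^sup>2 * (H + 1) + 1) \<le> 69 * (c ^ 8 * L)"
      using L(3) by (simp add: algebra_simps)
    then show ?thesis
      unfolding of_nat_mult[of _ "length ps"] by (intro mult_right_mono) auto
  qed simp
  moreover have "real n \<le> real ((17 * K\<^sup>2 * (H + 1) + 1) * length ps)"
    using T(5) by (rule of_nat_mono)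
  moreover have "0 \<le> c ^ 8 * L * real (length ps)"
    using L(3) by simp
  \<comment> \<open>The 3 extra operations are charged to the root, as \<open>R\<close> has one
    element more than \<open>ps\<close>.\<close>
  ultimately have "real (n + 3) \<le> 1000 * (c ^ 8 * L) * real (card R)"
    using L(3) unfolding card by (simp add: algebra_simps)
  then have "ereal (real (n + 3)) \<le> 1000 * minimized_expansion_constant R ^ 8
      * ereal (max 1 (log 2 (aspect_ratio R))) * ereal (real (card R))"
    unfolding c(1) L_def[symmetric] by (simp add: numeral_eq_ereal mult.assoc)
  moreover have "build_tree ch r ps = Some (set_root_level T, n + 3)"
    using T(1) by (simp add: build_tree_def)
  moreover have "compressed_cover_tree R (set_root_level T)" "root_node (set_root_level T) = r"
    using partial_cover_tree.compressed_cover_tree_set_root_level[OF T(2)] T(3,4)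
    by (simp_all add: set_root_level_def)
  ultimately show ?thesis
    by blast
qed

end
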